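(* Let $k\ge 0$ be a fixed integer and let $r_{k,n}$ be the number of relaxed trees of size $n$ with right height at most $k$. Then there is a constant $\gamma_k\in\mathbb{R}$, independent of $n$, such that, as $n\to\infty$, $$ r_{k,n}\sim \gamma_k\, n!\,\left(4\cos^2\!\left(\frac{\pi}{k+3}\right)\right)^{n} n^{-k/2}. $$
   Context: A full binary tree is a rooted plane tree in which every node has either $0$ or $2$ (ordered: left, right) children. A relaxed tree of size $n\ge 0$ is obtained as follows: take a full binary tree $T$ with $n$ internal nodes (and $n+1$ leaves) and traverse it in post-order (left subtree, right subtree, then the node). The first leaf visited is kept as the unique leaf (sink). Every other leaf $\lambda$ is replaced by a pointer to a node $v$, where $v$ is either an internal node of $T$ or the kept leaf, and $v$ is visited before $\lambda$ in the post-order traversal. Two relaxed trees are equal iff they have the same underlying tree $T$ and the same pointer targets. The spine of a relaxed tree is the binary tree formed by the internal nodes of $T$ and the edges of $T$ between them (pointers and the leaf are removed). The level of a spine node is the number of right edges on the spine path from the root to it; the right height is the maximal level of a spine node. *)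

theory Defs
  imports "HOL-Library.Tree" "HOL-Library.Landau_Symbols"
begin

text \<open>
  A full binary tree is a value of type \<open>unit tree\<close>: \<open>Node l () r\<close> is an internal node with
  ordered children, and \<open>Leaf\<close> is a genuine leaf, so \<open>size\<close> counts the internal nodes.
  A node (internal or leaf) is named by its address, the list of directions of the edges on
  the path from the root to it; the root is \<open>[]\<close>.
\<close>

datatype dir = Lft | Rgt

type_synonym addr = "dir list"

fun inner_nodes :: "unit tree \<Rightarrow> addr set" where
  "inner_nodes Leaf = {}"
| "inner_nodes (Node l _ r) =
     {[]} \<union> (#) Lft ` inner_nodes l \<union> (#) Rgt ` inner_nodes r"

fun leaf_nodes :: "unit tree \<Rightarrow> addr set" where
  "leaf_nodes Leaf = {[]}"
| "leaf_nodes (Node l _ r) = (#) Lft ` leaf_nodes l \<union> (#) Rgt ` leaf_nodes r"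

fun post_order :: "unit tree \<Rightarrow> addr list" where
  "post_order Leaf = [[]]"
| "post_order (Node l _ r) =
     map ((#) Lft) (post_order l) @ map ((#) Rgt) (post_order r) @ [[]]"

definition visited_before :: "unit tree \<Rightarrow> addr \<Rightarrow> addr \<Rightarrow> bool" where
  "visited_before t u v \<longleftrightarrow>
     (\<exists>i j. i < j \<and> j < length (post_order t) \<and> post_order t ! i = u \<and> post_order t ! j = v)"

definition sink :: "unit tree \<Rightarrow> addr" where
  "sink t = hd (filter (\<lambda>u. u \<in> leaf_nodes t) (post_order t))"

text \<open>
  A relaxed tree is a pair of a tree and a pointer map. The map is undefined outside the
  leaves that are replaced, so equality of pairs is equality of trees and of pointer targets.
\<close>

type_synonym pointed_tree = "unit tree \<times> (addr \<rightharpoonup> addr)"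

definition relaxed_tree :: "pointed_tree \<Rightarrow> bool" where
  "relaxed_tree = (\<lambda>(t, p).
     dom p = leaf_nodes t - {sink t} \<and>
     (\<forall>u v. p u = Some v \<longrightarrow>
        v \<in> inner_nodes t \<union> {sink t} \<and> visited_before t v u))"

text \<open>
  The nodes of the spine are the internal nodes. Ancestors of internal nodes are internal, so
  the address of such a node also describes the spine path from the root to it.
\<close>

definition level :: "addr \<Rightarrow> nat" where
  "level u = count_list u Rgt"

text \<open>
  Inserting \<open>0\<close> (the level of the root) only matters for the empty spine of the relaxed tree
  of size \<open>0\<close>, which gets right height \<open>0\<close>.
\<close>

definition right_height :: "unit tree \<Rightarrow> nat" where
  "right_height t = Max (insert 0 (level ` inner_nodes t))"

definition relaxed_count :: "nat \<Rightarrow> nat \<Rightarrow> nat" where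
  "relaxed_count k n =
     card {(t, p). relaxed_tree (t, p) \<and> size t = n \<and> right_height t \<le> k}"

end

theory Submission
  imports Defs "HOL-Analysis.Analysis" "HOL-Real_Asymp.Real_Asymp"
begin

text \<open>
  Building a tree in post-order with a stack, a leaf is a push and an inner node merges the two
  top entries; a push made after \<open>m\<close> merges carries the weight \<open>m + 1\<close>, the number of possible
  pointer targets. Right height at most \<open>k\<close> confines the stack size to \<open>{1..k + 2}\<close>. Grouping
  the pushes between consecutive merges gives a linear recurrence in \<open>m\<close> for the vector of
  weighted counts. After division by \<open>m! (m + 1)\<^sup>h\<close> its matrix converges, and the Perron
  eigenvectors of the limit are explicit in sines of multiples of \<open>\<pi>/(k + 3)\<close>. Conjugating with
  the right eigenvector turns the recurrence into a Markov chain whose column \<open>j\<close> is damped by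
  \<open>1 - (j - 1)/m + O(1/m\<^sup>2)\<close>. The chain forgets its state geometrically, so the damping averages
  to \<open>1 - (k/2)/m + O(1/m\<^sup>2)\<close>, which produces \<open>n\<close> to the power \<open>-k/2\<close>.
\<close>

section \<open>Relaxed trees as weighted trees\<close>

lemma finite_inner_nodes: "finite (inner_nodes t)"
  by (induction t) auto

lemma finite_leaf_nodes: "finite (leaf_nodes t)"
  by (induction t) auto

lemma card_inner_nodes: "card (inner_nodes t) = size t"
proof (induction t)
  case (Node l x r)
  have "card (inner_nodes (Node l x r)) = Suc (card ((#) Lft ` inner_nodes l \<union> (#) Rgt ` inner_nodes r))"
    by (auto simp: finite_inner_nodes intro!: card_insert_disjoint)
  also have "\<dots> = Suc (card ((#) Lft ` inner_nodes l) + card ((#) Rgt ` inner_nodes r))"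
    by (subst card_Un_disjoint) (auto simp: finite_inner_nodes)
  finally show ?case using Node by (simp add: card_image)
qed simp

lemma inner_leaf_disjoint: "inner_nodes t \<inter> leaf_nodes t = {}"
  by (induction t) auto

lemma set_post_order: "set (post_order t) = inner_nodes t \<union> leaf_nodes t"
  by (induction t) auto

lemma distinct_post_order: "distinct (post_order t)"
  by (induction t) (auto simp: distinct_map)

section \<open>Precedence in post-order and the sink\<close>

text \<open>Recursive counterpart of \<open>visited_before\<close> that commutes with
  \<open>@\<close> and \<open>map\<close>. If \<open>u\<close> does not occur, all entries count as
  preceding it.\<close>

fun before :: "'a list \<Rightarrow> 'a \<Rightarrow> 'a set" where
  "before [] u = {}"
| "before (x # xs) u = (if x = u then {} else insert x (before xs u))"

lemma before_append: "before (xs @ ys) u = (if u \<in> set xs then before xs u else set xs \<union> before ys u)"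
  by (induction xs) auto

lemma before_map: "inj f \<Longrightarrow> before (map f xs) (f u) = f ` before xs u"
  by (induction xs) (auto simp: inj_def)

lemma before_iff_nth:
  assumes "distinct xs"  "u \<in> set xs"
  shows "v \<in> before xs u \<longleftrightarrow> (\<exists>i j. i < j \<and> j < length xs \<and> xs ! i = v \<and> xs ! j = u)"
  using assms
proof (induction xs)
  case (Cons x xs)
  have *: "(\<exists>i j. i < j \<and> j < length (x # xs) \<and> (x # xs) ! i = v \<and> (x # xs) ! j = u) \<longleftrightarrow>
     (x = v \<and> u \<in> set xs) \<or> (\<exists>i j. i < j \<and> j < length xs \<and> xs ! i = v \<and> xs ! j = u)" (is "?L = ?R")
  proof
    assume ?L
    then obtain i j where ij: "i < j" "j < length (x # xs)" "(x # xs) ! i = v" "(x # xs) ! j = u" by blast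
    then obtain j' where j: "j = Suc j'" by (cases j) auto
    show ?R using ij j by (cases i) auto
  next
    assume ?R
    thus ?L
    proof (elim disjE exE conjE)
      assume "x = v" "u \<in> set xs"
      then obtain j where "j < length xs" "xs ! j = u" by (auto simp: in_set_conv_nth)
      with \<open>x = v\<close> show ?thesis by (intro exI[of _ 0] exI[of _ "Suc j"]) auto
    next
      fix i j assume "i < j" "j < length xs" "xs ! i = v" "xs ! j = u"
      thus ?thesis by (intro exI[of _ "Suc i"] exI[of _ "Suc j"]) auto
    qed
  qed
  show ?case
  proof (cases "x = u")
    case True
    hence "u \<notin> set xs" using Cons by auto
    thus ?thesis unfolding * using True by (auto simp: in_set_conv_nth)
  next
    case False
    thus ?thesis unfolding * using Cons by auto
  qed
qed simp

lemma visited_before_iff: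
  "u \<in> leaf_nodes t \<Longrightarrow> visited_before t v u \<longleftrightarrow> v \<in> before (post_order t) u"
  unfolding visited_before_def
  by (subst before_iff_nth) (auto simp: distinct_post_order set_post_order)

lemma leaf_nodes_nonempty: "leaf_nodes t \<noteq> {}"
  by (induction t) auto

lemma hd_filter_before:
  "\<exists>x\<in>set xs. P x \<Longrightarrow> hd (filter P xs) \<in> set xs \<and> P (hd (filter P xs)) \<and>
    (\<forall>u\<in>set xs. P u \<longrightarrow> u \<noteq> hd (filter P xs) \<longrightarrow> hd (filter P xs) \<in> before xs u)"
  by (induction xs) auto

text \<open>The first leaf precedes every other one, so it is always an admissible target; this is
  the \<open>+ 1\<close> in the weight of a leaf.\<close>

lemma sink_props:
  "sink t \<in> leaf_nodes t"
  "u \<in> leaf_nodes t \<Longrightarrow> u \<noteq> sink t \<Longrightarrow> sink t \<in> before (post_order t) u"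
  using hd_filter_before[of "post_order t" "\<lambda>u. u \<in> leaf_nodes t"] leaf_nodes_nonempty[of t]
  by (auto simp: sink_def set_post_order)

section \<open>Leaf weights and the number of pointer maps\<close>

definition inner_before :: "unit tree \<Rightarrow> addr \<Rightarrow> nat" where
  "inner_before t u = card (inner_nodes t \<inter> before (post_order t) u)"

lemma inner_before_Lft:
  assumes "u \<in> leaf_nodes l"
  shows "inner_before (Node l x r) (Lft # u) = inner_before l u"
proof -
  have u: "u \<in> set (post_order l)" using assms by (simp add: set_post_order)
  have "inner_nodes (Node l x r) \<inter> before (post_order (Node l x r)) (Lft # u) =
    (#) Lft ` (inner_nodes l \<inter> before (post_order l) u)"
    using u by (auto simp: before_append before_map)
  thus ?thesis by (simp add: inner_before_def card_image)
qed

text \<open>The left subtree is complete before the right one starts, while the root comes last and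
  precedes no leaf.\<close>

lemma inner_before_Rgt:
  assumes "u \<in> leaf_nodes r"
  shows "inner_before (Node l x r) (Rgt # u) = size l + inner_before r u"
proof -
  have u: "u \<in> set (post_order r)" using assms by (simp add: set_post_order)
  have "inner_nodes (Node l x r) \<inter> before (post_order (Node l x r)) (Rgt # u) =
    (#) Lft ` inner_nodes l \<union> (#) Rgt ` (inner_nodes r \<inter> before (post_order r) u)"
    using u by (auto simp: before_append before_map set_post_order)
  also have "card \<dots> = size l + inner_before r u"
    by (subst card_Un_disjoint) (auto simp: finite_inner_nodes card_image inner_before_def card_inner_nodes)
  finally show ?thesis by (simp add: inner_before_def)
qed

text \<open>
  \<open>m\<close> is the number of inner nodes visited before the subtree is entered. The first leaf of the
  whole tree contributes the factor \<open>1\<close> when \<open>m = 0\<close>, so the sink needs no special treatment.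
\<close>

fun weight :: "nat \<Rightarrow> unit tree \<Rightarrow> nat" where
  "weight m Leaf = m + 1"
| "weight m (Node l _ r) = weight m l * weight (m + size l) r"

text \<open>The general \<open>m\<close> carries the induction: the right subtree starts with the
  offset \<open>m + size l\<close>.\<close>

lemma weight_eq_prod: "weight m t = (\<Prod>u\<in>leaf_nodes t. m + inner_before t u + 1)"
proof (induction t arbitrary: m)
  case Leaf
  show ?case by (simp add: inner_before_def)
next
  case (Node l x r)
  have "(\<Prod>u\<in>leaf_nodes (Node l x r). m + inner_before (Node l x r) u + 1) =
    (\<Prod>u\<in>(#) Lft ` leaf_nodes l. m + inner_before (Node l x r) u + 1) *
    (\<Prod>u\<in>(#) Rgt ` leaf_nodes r. m + inner_before (Node l x r) u + 1)"
    by (simp only: leaf_nodes.simps, subst prod.union_disjoint) (auto simp: finite_leaf_nodes)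
  also have "\<dots> = (\<Prod>u\<in>leaf_nodes l. m + inner_before l u + 1) * (\<Prod>u\<in>leaf_nodes r. (m + size l) + inner_before r u + 1)"
    by (intro arg_cong2[where f = "(*)"]; subst prod.reindex)
       (auto intro!: prod.cong simp: inner_before_Lft inner_before_Rgt)
  finally show ?case using Node by simp
qed

text \<open>A partial map with domain \<open>A\<close> is encoded by an extensional function in the
  dependent product over \<open>A\<close>, whose cardinality is known.\<close>

lemma card_partial_maps:
  assumes "finite A" "\<And>u. u \<in> A \<Longrightarrow> finite (S u)"
  shows "card {p. dom p = A \<and> (\<forall>u v. p u = Some v \<longrightarrow> v \<in> S u)} = (\<Prod>u\<in>A. card (S u))"
proof -
  have "bij_betw (\<lambda>f u. if u \<in> A then Some (f u) else None) (Pi\<^sub>E A S)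
     {p. dom p = A \<and> (\<forall>u v. p u = Some v \<longrightarrow> v \<in> S u)}"
  proof (rule bij_betwI[where g = "\<lambda>p. restrict (\<lambda>u. the (p u)) A"])
    show "(\<lambda>f u. if u \<in> A then Some (f u) else None) \<in> Pi\<^sub>E A S \<rightarrow> {p. dom p = A \<and> (\<forall>u v. p u = Some v \<longrightarrow> v \<in> S u)}"
      by (auto split: if_splits)
    show "(\<lambda>p. restrict (\<lambda>u. the (p u)) A) \<in> {p. dom p = A \<and> (\<forall>u v. p u = Some v \<longrightarrow> v \<in> S u)} \<rightarrow> Pi\<^sub>E A S"
    proof
      fix p assume p: "p \<in> {p. dom p = A \<and> (\<forall>u v. p u = Some v \<longrightarrow> v \<in> S u)}"
      have "the (p u) \<in> S u" if "u \<in> A" for u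
        using p that by (cases "p u") auto
      thus "restrict (\<lambda>u. the (p u)) A \<in> Pi\<^sub>E A S" by auto
    qed
    show "restrict (\<lambda>u. the (if u \<in> A then Some (f u) else None)) A = f" if "f \<in> Pi\<^sub>E A S" for f
    proof
      show "restrict (\<lambda>u. the (if u \<in> A then Some (f u) else None)) A u = f u" for u
        using PiE_arb[OF that, of u] by simp
    qed
    show "(\<lambda>u. if u \<in> A then Some (restrict (\<lambda>u. the (p u)) A u) else None) = p"
      if "p \<in> {p. dom p = A \<and> (\<forall>u v. p u = Some v \<longrightarrow> v \<in> S u)}" for p
    proof
      show "(if u \<in> A then Some (restrict (\<lambda>u. the (p u)) A u) else None) = p u" for u
        using that by (cases "p u") auto
    qed
  qed
  from bij_betw_same_card[OF this] show ?thesis using assms(1) by (simp add: card_PiE)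
qed

lemma relaxed_tree_maps:
  "{p. relaxed_tree (t, p)} = {p. dom p = leaf_nodes t - {sink t} \<and>
     (\<forall>u v. p u = Some v \<longrightarrow> v \<in> (inner_nodes t \<union> {sink t}) \<inter> before (post_order t) u)}"
proof (rule Collect_cong)
  fix p
  have "visited_before t v u \<longleftrightarrow> v \<in> before (post_order t) u"
    if "dom p = leaf_nodes t - {sink t}" "p u = Some v" for u v
    using that by (intro visited_before_iff) auto
  thus "relaxed_tree (t, p) \<longleftrightarrow> dom p = leaf_nodes t - {sink t} \<and>
     (\<forall>u v. p u = Some v \<longrightarrow> v \<in> (inner_nodes t \<union> {sink t}) \<inter> before (post_order t) u)"
    by (simp add: relaxed_tree_def cong: conj_cong)
qed

lemma finite_relaxed_tree_maps: "finite {p. relaxed_tree (t, p)}"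
proof (rule finite_subset)
  show "{p. relaxed_tree (t, p)} \<subseteq> {p. dom p \<subseteq> leaf_nodes t \<and> ran p \<subseteq> inner_nodes t \<union> {sink t}}"
    by (auto simp: relaxed_tree_maps ran_def)
  have "{p. dom p \<subseteq> leaf_nodes t \<and> ran p \<subseteq> inner_nodes t \<union> {sink t}} =
    (\<Union>B\<in>Pow (leaf_nodes t). {p. dom p = B \<and> ran p \<subseteq> inner_nodes t \<union> {sink t}})" by auto
  also have "finite \<dots>"
    using finite_leaf_nodes finite_inner_nodes
    by (intro finite_UN_I finite_set_of_finite_maps) (auto intro: finite_subset)
  finally show "finite {p. dom p \<subseteq> leaf_nodes t \<and> ran p \<subseteq> inner_nodes t \<union> {sink t}}" .
qed

text \<open>The sink is the leftmost leaf; its factor in \<open>weight 0 t\<close> is therefore 1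
  and may be included in the product.\<close>

lemma before_sink: "inner_before t (sink t) = 0"
proof (induction t)
  case Leaf
  show ?case by (simp add: inner_before_def)
next
  case (Node l x r)
  have "filter (\<lambda>u. u \<in> leaf_nodes (Node l x r)) (map ((#) Lft) (post_order l)) = map ((#) Lft) (filter (\<lambda>u. u \<in> leaf_nodes l) (post_order l))"
    by (auto simp: filter_map intro!: filter_cong arg_cong[where f = "map _"])
  moreover have "filter (\<lambda>u. u \<in> leaf_nodes l) (post_order l) \<noteq> []"
    using leaf_nodes_nonempty[of l] by (auto simp: filter_empty_conv set_post_order)
  ultimately have "sink (Node l x r) = Lft # sink l"
    unfolding sink_def by (simp add: hd_append hd_map)
  thus ?case using inner_before_Lft[OF sink_props(1)] Node by simp
qed

text \<open>Replaced leaves choose their targets independently, each among the earlier inner nodes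
  and the sink.\<close>

lemma card_relaxed_tree_maps: "card {p. relaxed_tree (t, p)} = weight 0 t"
proof -
  have "card {p. relaxed_tree (t, p)} =
    (\<Prod>u\<in>leaf_nodes t - {sink t}. card ((inner_nodes t \<union> {sink t}) \<inter> before (post_order t) u))"
    unfolding relaxed_tree_maps
    by (rule card_partial_maps) (auto simp: finite_leaf_nodes finite_inner_nodes)
  also have "\<dots> = (\<Prod>u\<in>leaf_nodes t - {sink t}. inner_before t u + 1)"
  proof (rule prod.cong)
    fix u assume u: "u \<in> leaf_nodes t - {sink t}"
    hence "(inner_nodes t \<union> {sink t}) \<inter> before (post_order t) u = insert (sink t) (inner_nodes t \<inter> before (post_order t) u)"
      using sink_props(2)[of u t] by auto
    moreover have "sink t \<notin> inner_nodes t" using sink_props(1)[of t] inner_leaf_disjoint[of t] by auto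
    ultimately show "card ((inner_nodes t \<union> {sink t}) \<inter> before (post_order t) u) = inner_before t u + 1"
      by (simp add: finite_inner_nodes inner_before_def)
  qed simp
  also have "\<dots> = (\<Prod>u\<in>leaf_nodes t. inner_before t u + 1)"
    using sink_props(1)[of t] by (simp add: prod.remove[of _ "sink t"] finite_leaf_nodes before_sink)
  finally show ?thesis by (simp add: weight_eq_prod)
qed

section \<open>Weighted counts of trees of bounded right depth\<close>

text \<open>The largest number of right edges on a path from the root to a leaf. It exceeds the
  right height by one on a nonempty tree and has a recursion free of special cases.\<close>

fun right_depth :: "unit tree \<Rightarrow> nat" where
  "right_depth Leaf = 0"
| "right_depth (Node l _ r) = max (right_depth l) (Suc (right_depth r))"

lemma right_height_le_iff: "right_height t \<le> k \<longleftrightarrow> (\<forall>u\<in>inner_nodes t. level u \<le> k)"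
  unfolding right_height_def by (subst Max_le_iff) (auto simp: finite_inner_nodes)

lemma level_simps [simp]:
  "level [] = 0" "level (Lft # u) = level u" "level (Rgt # u) = Suc (level u)"
  by (simp_all add: level_def)

lemma right_depth_le_iff: "right_depth t \<le> k \<longleftrightarrow> (\<forall>u\<in>inner_nodes t. level u < k)"
proof (induction t arbitrary: k)
  case (Node l x r)
  show ?case
    by (cases k) (auto simp: Node ball_Un)
qed simp

lemma right_height_iff_right_depth: "right_height t \<le> k \<longleftrightarrow> right_depth t \<le> Suc k"
  by (auto simp: right_height_le_iff right_depth_le_iff)

definition trees :: "nat \<Rightarrow> nat \<Rightarrow> unit tree set" where
  "trees b n = {t. size t = n \<and> right_depth t \<le> b}"

definition trees_weight :: "nat \<Rightarrow> nat \<Rightarrow> nat \<Rightarrow> nat" where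
  "trees_weight b n m = (\<Sum>t\<in>trees b n. weight m t)"

lemma trees_0: "trees b 0 = {Leaf}"
  by (auto simp: trees_def)

text \<open>Splitting at the root: passing to the right subtree uses up one unit of the bound. The
  case \<open>b = 0\<close> is separate because \<open>b - 1\<close> truncates.\<close>

lemma trees_Suc:
  "trees b (Suc n) = (if b = 0 then {} else
     (\<lambda>(i, l, r). Node l () r) ` (SIGMA i:{..n}. trees b i \<times> trees (b - 1) (n - i)))" (is "_ = ?R")
proof -
  have "t \<in> trees b (Suc n) \<longleftrightarrow> t \<in> ?R" for t
  proof (cases t)
    case Leaf
    thus ?thesis by (auto simp: trees_def)
  next
    case (Node l x r)
    have "t \<in> ?R \<longleftrightarrow> b \<noteq> 0 \<and> (\<exists>i\<le>n. l \<in> trees b i \<and> r \<in> trees (b - 1) (n - i))"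
      by (simp add: Node image_iff Bex_def)
    also have "\<dots> \<longleftrightarrow> b \<noteq> 0 \<and> size l \<le> n \<and> right_depth l \<le> b \<and> size r = n - size l \<and> right_depth r \<le> b - 1"
      by (auto simp: trees_def)
    also have "\<dots> \<longleftrightarrow> t \<in> trees b (Suc n)"
      by (cases b) (auto simp: Node trees_def)
    finally show ?thesis by simp
  qed
  thus ?thesis by blast
qed

lemma finite_trees: "finite (trees b n)"
proof (induction n arbitrary: b rule: less_induct)
  case (less n)
  show ?case
    by (cases n) (auto simp: trees_0 trees_Suc less intro!: finite_imageI)
qed

lemma trees_weight_0: "trees_weight b 0 m = m + 1"
  by (simp add: trees_weight_def trees_0)

lemma trees_weight_Suc_0: "trees_weight 0 (Suc n) m = 0"
  by (simp add: trees_weight_def trees_Suc)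

text \<open>The right subtree is entered after the \<open>i\<close> inner nodes of the left one,
  hence the start \<open>m + i\<close>.\<close>

lemma trees_weight_Suc_Suc: "trees_weight (Suc b) (Suc n) m = (\<Sum>i\<le>n. trees_weight (Suc b) i m * trees_weight b (n - i) (m + i))"
proof -
  have inj: "inj_on (\<lambda>(i, l, r). Node l () r) (SIGMA i:{..n}. trees (Suc b) i \<times> trees b (n - i))"
    by (auto simp: inj_on_def trees_def)
  have "trees_weight (Suc b) (Suc n) m = (\<Sum>(i, l, r)\<in>(SIGMA i:{..n}. trees (Suc b) i \<times> trees b (n - i)). weight m (Node l () r))"
    unfolding trees_weight_def trees_Suc using inj by (simp add: sum.reindex case_prod_unfold o_def)
  also have "\<dots> = (\<Sum>i\<le>n. \<Sum>(l, r)\<in>trees (Suc b) i \<times> trees b (n - i). weight m l * weight (m + size l) r)"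
    by (subst sum.Sigma) (auto simp: finite_trees)
  also have "\<dots> = (\<Sum>i\<le>n. \<Sum>(l, r)\<in>trees (Suc b) i \<times> trees b (n - i). weight m l * weight (m + i) r)"
    by (intro sum.cong refl) (auto simp: trees_def)
  also have "\<dots> = (\<Sum>i\<le>n. trees_weight (Suc b) i m * trees_weight b (n - i) (m + i))"
    by (simp add: trees_weight_def sum_product sum.cartesian_product)
  finally show ?thesis .
qed

lemma relaxed_count_eq_trees_weight: "relaxed_count k n = trees_weight (Suc k) n 0"
proof -
  have "{(t, p). relaxed_tree (t, p) \<and> size t = n \<and> right_height t \<le> k} =
     (SIGMA t:trees (Suc k) n. {p. relaxed_tree (t, p)})"
    by (auto simp: trees_def right_height_iff_right_depth)
  thus ?thesis unfolding relaxed_count_def trees_weight_def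
    by (simp add: card_SigmaI finite_trees finite_relaxed_tree_maps card_relaxed_tree_maps)
qed

section \<open>Stacks of subtrees and the transfer recurrence\<close>

text \<open>
  A stack of \<open>h + 1\<close> finished subtrees with \<open>m\<close> inner nodes in total; the subtree in position
  \<open>i\<close> hangs at level \<open>i\<close> and so has right depth at most \<open>b - i\<close>.
\<close>

fun forest_weight :: "nat \<Rightarrow> nat \<Rightarrow> nat \<Rightarrow> nat" where
  "forest_weight b 0 m = trees_weight b m 0"
| "forest_weight b (Suc h) m = (\<Sum>i\<le>m. forest_weight b h i * trees_weight (b - Suc h) (m - i) i)"

lemma forest_weight_at_0: "forest_weight b h 0 = 1"
  by (induction h) (auto simp: trees_weight_0)

text \<open>A single entry that is not a leaf comes from a merge; undoing it leaves two
  entries.\<close>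

lemma forest_weight_0_Suc: "forest_weight (Suc b) 0 (Suc m) = forest_weight (Suc b) 1 m"
  by (simp add: trees_weight_Suc_Suc)

text \<open>
  The top of the stack is either a leaf or a node; undoing the node replaces it by its two
  children.
\<close>

lemma forest_weight_Suc_Suc:
  assumes "Suc h \<le> b"
  shows "forest_weight b (Suc h) (Suc m) = (m + 2) * forest_weight b h (Suc m) + (if Suc h < b then forest_weight b (Suc (Suc h)) m else 0)"
proof -
  \<comment> \<open>The summand \<open>i = Suc m\<close> is split off: there the top entry is a leaf
    pushed after \<open>m + 1\<close> merges, of weight \<open>m + 2\<close>.\<close>
  have "forest_weight b (Suc h) (Suc m) = (\<Sum>i\<le>m. forest_weight b h i * trees_weight (b - Suc h) (Suc m - i) i) + (m + 2) * forest_weight b h (Suc m)"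
    by (simp add: trees_weight_0)
  also have "(\<Sum>i\<le>m. forest_weight b h i * trees_weight (b - Suc h) (Suc m - i) i) = (if Suc h < b then forest_weight b (Suc (Suc h)) m else 0)"
  proof (cases "Suc h < b")
    case False
    \<comment> \<open>At position \<open>b\<close> only a leaf respects the bound on the right
      depth.\<close>
    hence "b - Suc h = 0" by simp
    thus ?thesis using False by (simp add: Suc_diff_le trees_weight_Suc_0)
  next
    case True
    then obtain c where c: "b - Suc h = Suc c" by (metis zero_less_diff gr0_implies_Suc)
    hence c': "b - Suc (Suc h) = c" by simp
    have "forest_weight b (Suc (Suc h)) m = (\<Sum>j\<le>m. (\<Sum>i\<le>j. forest_weight b h i * trees_weight (Suc c) (j - i) i) * trees_weight c (m - j) j)"
      using c c' by simp
    also have "\<dots> = (\<Sum>j\<le>m. \<Sum>i\<le>j. forest_weight b h i * trees_weight (Suc c) (j - i) i * trees_weight c (m - j) j)"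
      by (simp add: sum_distrib_right)
    \<comment> \<open>Exchanging the sums fixes the number \<open>i\<close> of inner nodes below the
      top entry; the inner sum becomes the root decomposition of that entry.\<close>
    also have "\<dots> = (\<Sum>i\<le>m. \<Sum>j=i..m. forest_weight b h i * trees_weight (Suc c) (j - i) i * trees_weight c (m - j) j)"
      unfolding sum.Sigma[OF finite_atMost ballI[OF finite_atMost]] sum.Sigma[OF finite_atMost ballI[OF finite_atLeastAtMost]]
      by (rule sum.reindex_bij_witness[of _ "\<lambda>(a, b). (b, a)" "\<lambda>(a, b). (b, a)"]) auto
    also have "\<dots> = (\<Sum>i\<le>m. forest_weight b h i * trees_weight (Suc c) (Suc (m - i)) i)"
    proof (rule sum.cong[OF refl])
      fix i assume "i \<in> {..m}"
      have "(\<Sum>j=i..m. forest_weight b h i * trees_weight (Suc c) (j - i) i * trees_weight c (m - j) j) =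
        (\<Sum>p\<le>m - i. forest_weight b h i * trees_weight (Suc c) p i * trees_weight c (m - (i + p)) (i + p))"
        using \<open>i \<in> {..m}\<close>
        by (intro sum.reindex_bij_witness[of _ "\<lambda>p. i + p" "\<lambda>j. j - i"]) auto
      thus "(\<Sum>j=i..m. forest_weight b h i * trees_weight (Suc c) (j - i) i * trees_weight c (m - j) j) = forest_weight b h i * trees_weight (Suc c) (Suc (m - i)) i"
        by (simp add: trees_weight_Suc_Suc sum_distrib_left mult.assoc diff_diff_eq)
    qed
    finally show ?thesis using True by (simp add: c Suc_diff_le)
  qed
  finally show ?thesis by simp
qed

text \<open>Unrolling the previous recurrence removes the leaves pushed since the last merge:
  \<open>Suc h - j\<close> of them, each of weight \<open>m + 2\<close>. Undoing that merge leaves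
  index \<open>j\<close>, which cannot exceed \<open>b\<close>.\<close>

lemma forest_weight_eq_sum:
  assumes "h \<le> b" "b > 0"
  shows "forest_weight b h (Suc m) = (\<Sum>j=1..min (Suc h) b. (m + 2) ^ (Suc h - j) * forest_weight b j m)"
  using assms(1)
proof (induction h)
  case 0
  show ?case using assms(2) forest_weight_0_Suc[of "b - 1" m] by (simp add: min_def)
next
  case (Suc h)
  have IH: "forest_weight b h (Suc m) = (\<Sum>j=1..Suc h. (m + 2) ^ (Suc h - j) * forest_weight b j m)"
    using Suc by (simp add: min_def)
  have *: "(m + 2) * forest_weight b h (Suc m) = (\<Sum>j=1..Suc h. (m + 2) ^ (Suc (Suc h) - j) * forest_weight b j m)"
    unfolding IH sum_distrib_left by (intro sum.cong) (auto simp: Suc_diff_le algebra_simps)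
  show ?case unfolding forest_weight_Suc_Suc[OF Suc.prems] *
    using Suc.prems by (auto simp: min_def)
qed

declare forest_weight.simps(2) [simp del]

section \<open>Slowly perturbed Markov chains\<close>

text \<open>Both distributions give \<open>s\<close> mass at least \<delta>. This common part
  cancels in the difference, and the remaining mass \<open>1 - \<delta>\<close> sees at most the
  oscillation \<omega>.\<close>

lemma doeblin_contraction_aux:
  fixes p q f :: "'a \<Rightarrow> real"
  assumes "finite J" "s \<in> J"
    and p: "\<And>j. j \<in> J \<Longrightarrow> 0 \<le> p j" "sum p J = 1" "\<delta> \<le> p s"
    and q: "\<And>j. j \<in> J \<Longrightarrow> 0 \<le> q j" "sum q J = 1" "\<delta> \<le> q s"
    and osc: "\<And>i j. i \<in> J \<Longrightarrow> j \<in> J \<Longrightarrow> \<bar>f i - f j\<bar> \<le> \<omega>"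
  shows "(\<Sum>j\<in>J. p j * f j) - (\<Sum>j\<in>J. q j * f j) \<le> (1 - \<delta>) * \<omega>"
proof -
  \<comment> \<open>Subtracting the minimum puts the values in [0, \<omega>]; both averages shift by
    the same \<open>a\<close>, as the total masses are 1.\<close>
  define a where "a = Min (f ` J)"
  define g where "g j = f j - a" for j
  have fin: "finite (f ` J)" "f ` J \<noteq> {}" using assms(1,2) by auto
  obtain i where i: "i \<in> J" "f i = a"
    using Min_in[OF fin] unfolding a_def by auto
  have g: "0 \<le> g j" "g j \<le> \<omega>" if "j \<in> J" for j
  proof -
    show "0 \<le> g j" using Min_le[OF fin(1)] that by (auto simp: a_def g_def)
    show "g j \<le> \<omega>" using osc[OF that i(1)] i(2) by (auto simp: g_def)
  qed
  have shift: "(\<Sum>j\<in>J. r j * f j) = (\<Sum>j\<in>J. r j * g j) + a" if "sum r J = 1" for r :: "'a \<Rightarrow> real"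
    using that by (simp add: g_def algebra_simps sum_subtractf flip: sum_distrib_left)
  have "(\<Sum>j\<in>J. p j * g j) = p s * g s + (\<Sum>j\<in>J - {s}. p j * g j)"
    using assms(1,2) by (simp add: sum.remove)
  also have "(\<Sum>j\<in>J - {s}. p j * g j) \<le> (\<Sum>j\<in>J - {s}. p j * \<omega>)"
    by (intro sum_mono mult_left_mono) (auto simp: g p)
  also have "\<dots> = (1 - p s) * \<omega>"
    using assms(1,2) p(2) by (simp add: sum_diff1 flip: sum_distrib_right)
  finally have 1: "(\<Sum>j\<in>J. p j * g j) \<le> p s * g s + (1 - p s) * \<omega>" by simp
  have "(p s - \<delta>) * g s \<le> (p s - \<delta>) * \<omega>"
    using g[OF assms(2)] p by (intro mult_left_mono) auto
  moreover have "\<delta> * g s \<le> q s * g s"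
    using q g[OF assms(2)] by (intro mult_right_mono) auto
  moreover have "q s * g s \<le> (\<Sum>j\<in>J. q j * g j)"
    using assms(1,2) g q by (intro member_le_sum) auto
  ultimately show ?thesis using 1 shift[OF p(2)] shift[OF q(2)] by (simp add: algebra_simps)
qed

lemma doeblin_contraction:
  fixes p q f :: "'a \<Rightarrow> real"
  assumes "finite J" "s \<in> J"
    and p: "\<And>j. j \<in> J \<Longrightarrow> 0 \<le> p j" "sum p J = 1" "\<delta> \<le> p s"
    and q: "\<And>j. j \<in> J \<Longrightarrow> 0 \<le> q j" "sum q J = 1" "\<delta> \<le> q s"
    and osc: "\<And>i j. i \<in> J \<Longrightarrow> j \<in> J \<Longrightarrow> \<bar>f i - f j\<bar> \<le> \<omega>"
  shows "\<bar>(\<Sum>j\<in>J. p j * f j) - (\<Sum>j\<in>J. q j * f j)\<bar> \<le> (1 - \<delta>) * \<omega>"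
  using doeblin_contraction_aux[of J s p \<delta> q f \<omega>] doeblin_contraction_aux[of J s q \<delta> p f \<omega>] assms
  by (simp add: abs_le_iff)

text \<open>The increments of \<open>ln (\<sigma> m * real m powr d)\<close> are O(1/m^2), hence
  summable; exponentiating the limit of the logarithm gives a positive number.\<close>

lemma converges_from_ratio:
  fixes \<sigma> :: "nat \<Rightarrow> real" and d :: real
  assumes pos: "\<And>m. \<sigma> m > 0"
    and ratio: "(\<lambda>m. \<sigma> (Suc m) / \<sigma> m - (1 - d / real m)) \<in> O(\<lambda>m. 1 / real m ^ 2)"
  shows "\<exists>\<gamma>>0. (\<lambda>m. \<sigma> m * real m powr d) \<longlonglongrightarrow> \<gamma>"
proof -
  \<comment> \<open>The relative increment is O(1/m), so \<open>ln (1 + x m)\<close> may be replaced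
    by \<open>x m\<close> up to O(1/m^2).\<close>
  define x where "x m = \<sigma> (Suc m) / \<sigma> m - 1" for m
  have "(\<lambda>m. 1 / real m ^ 2) \<in> O(\<lambda>m. 1 / real m)" by real_asymp
  with ratio have "(\<lambda>m. \<sigma> (Suc m) / \<sigma> m - (1 - d / real m)) \<in> O(\<lambda>m. 1 / real m)"
    by (rule landau_o.big_trans)
  moreover have "(\<lambda>m. d / real m) \<in> O(\<lambda>m. 1 / real m)"
    by (intro bigoI[of _ "\<bar>d\<bar>"]) auto
  ultimately have "(\<lambda>m. (\<sigma> (Suc m) / \<sigma> m - (1 - d / real m)) - d / real m) \<in> O(\<lambda>m. 1 / real m)"
    by (rule sum_in_bigo)
  hence xO: "x \<in> O(\<lambda>m. 1 / real m)" by (simp add: x_def[abs_def])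
  have "(\<lambda>m. 1 / real m) \<longlonglongrightarrow> 0" by real_asymp
  hence "(\<lambda>m. 1 / real m) \<in> o(\<lambda>_. 1)" by (intro smalloI_tendsto) auto
  with xO have "x \<in> o(\<lambda>_. 1)" by (rule landau_o.big_small_trans)
  hence "x \<longlonglongrightarrow> 0" by (auto dest: smalloD_tendsto)
  hence "\<forall>\<^sub>F m in sequentially. \<bar>x m\<bar> < 1/2"
    using tendstoD[of x 0 sequentially "1/2"] by (simp add: dist_real_def)
  hence "\<forall>\<^sub>F m in sequentially. norm (ln (1 + x m) - x m) \<le> 2 * norm (x m * x m)"
    by eventually_elim (use abs_ln_one_plus_x_minus_x_bound in \<open>auto simp: power2_eq_square\<close>)
  hence "(\<lambda>m. ln (1 + x m) - x m) \<in> O(\<lambda>m. x m * x m)" by (rule bigoI)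
  moreover have "(\<lambda>m. x m * x m) \<in> O(\<lambda>m. 1 / real m ^ 2)"
    using landau_o.big.mult[OF xO xO] by (simp add: power2_eq_square)
  ultimately have lnO: "(\<lambda>m. ln (1 + x m) - x m) \<in> O(\<lambda>m. 1 / real m ^ 2)"
    by (rule landau_o.big_trans)
  define g where "g m = ln (\<sigma> m * real m powr d)" for m
  have "(\<lambda>m. d * (ln (real (Suc m)) - ln (real m) - 1 / real m)) \<in> O(\<lambda>m. 1 / real m ^ 2)"
  proof -
    have "(\<lambda>m. ln (real (Suc m)) - ln (real m) - 1 / real m) \<in> O(\<lambda>m. 1 / real m ^ 2)"
      by real_asymp
    thus ?thesis by (cases "d = 0") auto
  qed
  from sum_in_bigo(1)[OF sum_in_bigo(1)[OF lnO ratio] this]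
  have O: "(\<lambda>m. (ln (1 + x m) - x m) + (\<sigma> (Suc m) / \<sigma> m - (1 - d / real m)) +
          d * (ln (real (Suc m)) - ln (real m) - 1 / real m)) \<in> O(\<lambda>m. 1 / real m ^ 2)" .
  \<comment> \<open>Exact splitting into three O(1/m^2) errors: of the logarithm, of the assumed
    ratio, and of \<open>ln (m + 1) - ln m\<close> against \<open>1 / m\<close>. The terms
    \<open>d / m\<close> cancel.\<close>
  have "\<forall>\<^sub>F m in sequentially. g (Suc m) - g m = (ln (1 + x m) - x m) + (\<sigma> (Suc m) / \<sigma> m - (1 - d / real m)) +
          d * (ln (real (Suc m)) - ln (real m) - 1 / real m)"
    using eventually_gt_at_top[of 0]
  proof eventually_elim
    case (elim m)
    have "ln (1 + x m) = ln (\<sigma> (Suc m)) - ln (\<sigma> m)"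
      using pos[of m] pos[of "Suc m"] by (simp add: x_def ln_div)
    thus ?case using elim pos[of m] pos[of "Suc m"]
      by (simp add: g_def x_def ln_mult ln_powr algebra_simps)
  qed
  from landau_o.big.in_cong[OF this, of "\<lambda>m. 1 / real m ^ 2"] O
  have gO: "(\<lambda>m. g (Suc m) - g m) \<in> O(\<lambda>m. 1 / real m ^ 2)" by simp
  have "summable (\<lambda>m. norm (1 / real m ^ 2))"
    using inverse_power_summable[of 2, where 'a=real] by (simp add: field_simps)
  from summable_comparison_test_bigo[OF this gO] have "summable (\<lambda>m. g (Suc m) - g m)" .
  hence "convergent g" by (simp add: summable_iff_convergent sum_lessThan_telescope convergent_diff_const_right_iff)
  then obtain L where "g \<longlonglongrightarrow> L" by (auto simp: convergent_def)
  hence "(\<lambda>m. exp (g m)) \<longlonglongrightarrow> exp L" by (intro tendsto_exp)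
  moreover have "\<forall>\<^sub>F m in sequentially. exp (g m) = \<sigma> m * real m powr d"
    using eventually_gt_at_top[of 0]
    by eventually_elim (use pos in \<open>auto simp: g_def\<close>)
  ultimately have "(\<lambda>m. \<sigma> m * real m powr d) \<longlonglongrightarrow> exp L" by (simp add: tendsto_cong)
  thus ?thesis using exp_gt_zero by blast
qed

text \<open>
  The normalised oscillation of \<open>z m\<close> is \<open>O(1/m)\<close>, because each step contracts it by the factor
  \<open>1 - \<delta>\<close> and the perturbation adds only \<open>O(1/m)\<close>. Hence the stationary average \<open>\<sigma> m\<close> satisfies
  \<open>\<sigma> (Suc m) = \<sigma> m * (1 - db / m + O(1/m\<^sup>2))\<close>.
\<close>

lemma perturbed_chain_asymptotics:
  fixes Q :: "'a \<Rightarrow> 'a \<Rightarrow> real" and w z :: "nat \<Rightarrow> 'a \<Rightarrow> real" and \<pi> d :: "'a \<Rightarrow> real"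
  assumes fin: "finite J" and s: "s \<in> J"
    and Q_nonneg: "\<And>h j. h \<in> J \<Longrightarrow> j \<in> J \<Longrightarrow> 0 \<le> Q h j"
    and Q_sum: "\<And>h. h \<in> J \<Longrightarrow> (\<Sum>j\<in>J. Q h j) = 1"
    and Q_s: "\<And>h. h \<in> J \<Longrightarrow> \<delta> \<le> Q h s" and \<delta>: "\<delta> > 0"
    and \<pi>_pos: "\<And>j. j \<in> J \<Longrightarrow> 0 < \<pi> j" and \<pi>_sum: "(\<Sum>j\<in>J. \<pi> j) = 1"
    and \<pi>_Q: "\<And>j. j \<in> J \<Longrightarrow> (\<Sum>h\<in>J. \<pi> h * Q h j) = \<pi> j"
    and z_pos: "\<And>m j. j \<in> J \<Longrightarrow> 0 < z m j"
    and z_Suc: "\<And>m h. h \<in> J \<Longrightarrow> z (Suc m) h = (\<Sum>j\<in>J. Q h j * (w m j * z m j))"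
    and w: "\<And>j. j \<in> J \<Longrightarrow> (\<lambda>m. w m j - (1 - d j / real m)) \<in> O(\<lambda>m. 1 / real m ^ 2)"
  shows "\<exists>\<gamma>>0. \<forall>h\<in>J. (\<lambda>m. z m h * real m powr (\<Sum>j\<in>J. \<pi> j * d j)) \<longlonglongrightarrow> \<gamma>"
proof -
  define \<sigma> where "\<sigma> m = (\<Sum>j\<in>J. \<pi> j * z m j)" for m
  define db where "db = (\<Sum>j\<in>J. \<pi> j * d j)"
  have J_ne: "J \<noteq> {}" using s by auto
  have \<sigma>_pos: "\<sigma> m > 0" for m
    unfolding \<sigma>_def using fin J_ne \<pi>_pos z_pos by (intro sum_pos) auto
  \<comment> \<open>Stationarity of \<pi> removes \<open>Q\<close>, leaving only the damping by
    \<open>w\<close>.\<close>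
  have \<sigma>_Suc: "\<sigma> (Suc m) = (\<Sum>j\<in>J. \<pi> j * (w m j * z m j))" for m
  proof -
    have "\<sigma> (Suc m) = (\<Sum>h\<in>J. \<Sum>j\<in>J. \<pi> h * Q h j * (w m j * z m j))"
      unfolding \<sigma>_def by (intro sum.cong) (auto simp: z_Suc sum_distrib_left mult.assoc)
    also have "\<dots> = (\<Sum>j\<in>J. \<Sum>h\<in>J. \<pi> h * Q h j * (w m j * z m j))"
      by (rule sum.swap)
    also have "\<dots> = (\<Sum>j\<in>J. \<pi> j * (w m j * z m j))"
      by (intro sum.cong) (auto simp: \<pi>_Q simp flip: sum_distrib_right)
    finally show ?thesis .
  qed

  have "\<exists>c>0. \<forall>\<^sub>F m in sequentially. \<bar>w m j - (1 - d j / real m)\<bar> \<le> c / real m ^ 2" if j: "j \<in> J" for j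
  proof -
    obtain c where "c > 0"
      "\<forall>\<^sub>F m in sequentially. norm (w m j - (1 - d j / real m)) \<le> c * norm (1 / real m ^ 2)"
      using landau_o.bigE[OF w[OF j]] by blast
    thus ?thesis by (intro exI[of _ c]) simp
  qed
  hence "\<forall>j\<in>J. \<exists>c. c > 0 \<and>
      (\<forall>\<^sub>F m in sequentially. \<bar>w m j - (1 - d j / real m)\<bar> \<le> c / real m ^ 2)" by blast
  from bchoice[OF this] obtain c where c: "\<And>j. j \<in> J \<Longrightarrow> c j > 0"
      "\<And>j. j \<in> J \<Longrightarrow> \<forall>\<^sub>F m in sequentially. \<bar>w m j - (1 - d j / real m)\<bar> \<le> c j / real m ^ 2"
    by blast
  \<comment> \<open>One constant for all columns at once; \<open>D\<close> below also absorbs the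
    first-order terms \<open>d j / m\<close>.\<close>
  define C0 where "C0 = sum c J"
  have c_le: "c j \<le> C0" if "j \<in> J" for j
    unfolding C0_def using that fin c(1) by (intro member_le_sum) (auto intro: less_imp_le)
  have C0: "C0 \<ge> 0" unfolding C0_def by (intro sum_nonneg) (auto intro: less_imp_le c(1))
  have "\<forall>\<^sub>F m in sequentially. \<forall>j\<in>J. \<bar>w m j - (1 - d j / real m)\<bar> \<le> c j / real m ^ 2"
    using fin c(2) by (simp add: eventually_ball_finite)
  then obtain N0 where N0: "\<And>m j. m \<ge> N0 \<Longrightarrow> j \<in> J \<Longrightarrow> \<bar>w m j - (1 - d j / real m)\<bar> \<le> c j / real m ^ 2"
    by (auto simp: eventually_at_top_linorder)
  have w_close: "\<bar>w m j - (1 - d j / real m)\<bar> \<le> C0 / real m ^ 2" if "m \<ge> N0" "j \<in> J" for m j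
    using N0[OF that] divide_right_mono[OF c_le[OF that(2)], of "real m ^ 2"] by simp

  define D where "D = C0 + (\<Sum>j\<in>J. \<bar>d j\<bar>)"
  have d_le: "\<bar>d j\<bar> \<le> D - C0" if "j \<in> J" for j
    unfolding D_def using that fin member_le_sum[of j J "\<lambda>j. \<bar>d j\<bar>"] by simp
  have D: "D \<ge> 0" "D - C0 \<ge> 0" using C0 by (auto simp: D_def sum_nonneg)
  have w_1: "\<bar>w m j - 1\<bar> \<le> D / real m" if "m \<ge> N0" "m \<ge> 1" "j \<in> J" for m j
  proof -
    have "C0 / real m ^ 2 \<le> C0 / real m"
      using that C0 by (intro divide_left_mono) (auto simp: power2_eq_square)
    moreover have "\<bar>d j / real m\<bar> \<le> (D - C0) / real m"
      using divide_right_mono[OF d_le[OF that(3)], of "real m"] by (simp add: abs_divide)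
    ultimately show ?thesis using w_close[OF that(1,3)] unfolding diff_divide_distrib by linarith
  qed

  \<comment> \<open>The least stationary weight: no coordinate exceeds
    \<open>\<sigma> m / p\<close>, so errors can be measured against the average.\<close>
  define p where "p = Min (\<pi> ` J)"
  have p: "p > 0" "\<And>j. j \<in> J \<Longrightarrow> p \<le> \<pi> j"
    unfolding p_def using fin J_ne \<pi>_pos by auto
  have z_le: "z m j \<le> \<sigma> m / p" if "j \<in> J" for m j
  proof -
    have "p * z m j \<le> \<pi> j * z m j" using that p z_pos[of j m] by (intro mult_right_mono) auto
    also have "\<dots> \<le> \<sigma> m" unfolding \<sigma>_def
      using that fin by (intro member_le_sum) (auto intro!: mult_nonneg_nonneg less_imp_le[OF \<pi>_pos] less_imp_le[OF z_pos])
    finally show ?thesis using p(1) by (simp add: field_simps)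
  qed

  have \<sigma>_ge: "(1 - D / real m) * \<sigma> m \<le> \<sigma> (Suc m)" if m: "m \<ge> N0" "m \<ge> 1" for m
    unfolding \<sigma>_Suc unfolding \<sigma>_def sum_distrib_left
  proof (rule sum_mono)
    fix j assume j: "j \<in> J"
    have "(1 - D / real m) * (\<pi> j * z m j) \<le> w m j * (\<pi> j * z m j)"
      using w_1[OF m j] \<pi>_pos[OF j] z_pos[OF j, of m] by (intro mult_right_mono) auto
    thus "(1 - D / real m) * (\<pi> j * z m j) \<le> \<pi> j * (w m j * z m j)" by (simp add: mult_ac)
  qed

  \<comment> \<open>Each of the two compared rows deviates from its undamped average by at most
    \<open>D / m * (\<sigma> m / p)\<close>.\<close>
  define E where "E = 2 * D / p"
  have E: "E \<ge> 0" using D p by (simp add: E_def)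
  have osc_Suc: "\<bar>z (Suc m) h - z (Suc m) h'\<bar> \<le> (1 - \<delta>) * \<omega> + E / real m * \<sigma> m"
    if m: "m \<ge> N0" "m \<ge> 1" and h: "h \<in> J" "h' \<in> J"
      and \<omega>: "\<And>i j. i \<in> J \<Longrightarrow> j \<in> J \<Longrightarrow> \<bar>z m i - z m j\<bar> \<le> \<omega>" for m h h' \<omega>
  proof -
    have near: "\<bar>z (Suc m) g - (\<Sum>j\<in>J. Q g j * z m j)\<bar> \<le> D / real m * (\<sigma> m / p)" if g: "g \<in> J" for g
    proof -
      have "\<bar>z (Suc m) g - (\<Sum>j\<in>J. Q g j * z m j)\<bar> = \<bar>\<Sum>j\<in>J. Q g j * ((w m j - 1) * z m j)\<bar>"
        by (simp add: z_Suc g algebra_simps flip: sum_subtractf)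
      also have "\<dots> \<le> (\<Sum>j\<in>J. \<bar>Q g j * ((w m j - 1) * z m j)\<bar>)" by (rule sum_abs)
      also have "\<dots> \<le> (\<Sum>j\<in>J. Q g j * (D / real m * (\<sigma> m / p)))"
      proof (rule sum_mono)
        fix j assume j: "j \<in> J"
        have "\<bar>w m j - 1\<bar> * z m j \<le> D / real m * (\<sigma> m / p)"
          using w_1[OF m j] z_le[OF j] z_pos[OF j, of m] D by (intro mult_mono) auto
        hence "Q g j * (\<bar>w m j - 1\<bar> * z m j) \<le> Q g j * (D / real m * (\<sigma> m / p))"
          using Q_nonneg[OF g j] by (intro mult_left_mono)
        thus "\<bar>Q g j * ((w m j - 1) * z m j)\<bar> \<le> Q g j * (D / real m * (\<sigma> m / p))"
          using Q_nonneg[OF g j] z_pos[OF j, of m] by (simp add: abs_mult)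
      qed
      also have "\<dots> = D / real m * (\<sigma> m / p)" using Q_sum[OF g] by (simp only: sum_distrib_right[symmetric] mult_1)
      finally show ?thesis .
    qed
    have "\<bar>(\<Sum>j\<in>J. Q h j * z m j) - (\<Sum>j\<in>J. Q h' j * z m j)\<bar> \<le> (1 - \<delta>) * \<omega>"
      using fin s Q_nonneg Q_sum Q_s h \<omega> by (intro doeblin_contraction[where s = s]) auto
    moreover have "E / real m * \<sigma> m = 2 * (D / real m * (\<sigma> m / p))" by (simp add: E_def mult_ac)
    ultimately show ?thesis using near[OF h(1)] near[OF h(2)] by linarith
  qed

  have \<delta>_le: "\<delta> \<le> 1"
    using Q_s[OF s] Q_sum[OF s] member_le_sum[of s J "Q s"] fin s Q_nonneg by auto
  \<comment> \<open>From \<open>N\<close> on, half of the contraction \<delta> pays for the possible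
    drop of \<sigma> by the factor \<open>1 - D / m\<close> and for passing from 1/m to 1/(m +
    1).\<close>
  define N where "N = max (max N0 1) (nat \<lceil>2 * (D + 1) / \<delta>\<rceil>)"
  have N: "N \<ge> N0" "N \<ge> 1" by (auto simp: N_def)
  have N\<delta>: "D + 1 \<le> real m * \<delta> / 2" if "m \<ge> N" for m
  proof -
    have "2 * (D + 1) / \<delta> \<le> real m" using that unfolding N_def by linarith
    thus ?thesis using \<delta> by (simp add: field_simps)
  qed
  \<comment> \<open>The first entry makes the perturbation \<open>E\<close> fit into the other half
    of the contraction; the second starts the induction at \<open>N\<close>, where only
    \<open>z_le\<close> is available.\<close>
  define C where "C = max (2 * E / \<delta>) (real N / p)"
  have C: "C \<ge> 0" "E \<le> C * \<delta> / 2" "real N / p \<le> C"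
  proof -
    show "C \<ge> 0" using E \<delta> by (auto simp: C_def le_max_iff_disj)
    have "2 * E / \<delta> \<le> C" by (simp add: C_def)
    thus "E \<le> C * \<delta> / 2" using \<delta> by (simp add: field_simps)
  qed (simp add: C_def)
  have osc: "m \<ge> N \<Longrightarrow> \<forall>h\<in>J. \<forall>h'\<in>J. \<bar>z m h - z m h'\<bar> \<le> C / real m * \<sigma> m" for m
  proof (induction m rule: dec_induct)
    case base
    show ?case
    proof (intro ballI)
      fix h h' assume h: "h \<in> J" "h' \<in> J"
      have "\<bar>z N h - z N h'\<bar> \<le> \<sigma> N / p"
        using z_le[OF h(1), of N] z_le[OF h(2), of N] z_pos[OF h(1), of N] z_pos[OF h(2), of N] by linarith
      also have "\<dots> = (real N / p) / real N * \<sigma> N" using N p by (simp add: field_simps)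
      also have "\<dots> \<le> C / real N * \<sigma> N"
        using C(3) \<sigma>_pos[of N] by (intro mult_right_mono divide_right_mono) auto
      finally show "\<bar>z N h - z N h'\<bar> \<le> C / real N * \<sigma> N" .
    qed
  next
    case (step m)
    have m: "m \<ge> N0" "m \<ge> 1" using step N by auto
    have mD: "(1 - \<delta> / 2) * (real m + 1) \<le> real m - D"
      using N\<delta>[OF step(1)] \<delta> by (simp add: algebra_simps)
    have "0 < (1 - \<delta> / 2) * (real m + 1)" using \<delta>_le by (intro mult_pos_pos) auto
    hence mD_pos: "0 < real m - D" using mD by linarith
    show ?case
    proof (intro ballI)
      fix h h' assume h: "h \<in> J" "h' \<in> J"
      have "\<bar>z (Suc m) h - z (Suc m) h'\<bar> \<le> (1 - \<delta>) * (C / real m * \<sigma> m) + E / real m * \<sigma> m"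
        using osc_Suc[OF m h] step.IH by blast
      also have "\<dots> = ((1 - \<delta>) * C + E) * (\<sigma> m / real m)" by (simp add: distrib_right mult.assoc add_divide_distrib)
      also have "\<dots> \<le> ((1 - \<delta> / 2) * C) * (\<sigma> m / real m)"
        using C(2) \<sigma>_pos[of m] by (intro mult_right_mono) (auto simp: algebra_simps)
      also have "\<dots> \<le> ((1 - \<delta> / 2) * C) * (\<sigma> (Suc m) / (real m - D))"
      proof (rule mult_left_mono)
        have "\<sigma> m * (real m - D) / real m \<le> \<sigma> (Suc m)"
          using \<sigma>_ge[OF m] m by (simp add: field_simps)
        thus "\<sigma> m / real m \<le> \<sigma> (Suc m) / (real m - D)"
          using mD_pos m by (simp add: field_simps)
      qed (use C \<delta>_le in auto)
      also have "\<dots> = C * \<sigma> (Suc m) * ((1 - \<delta> / 2) / (real m - D))" by simp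
      also have "\<dots> \<le> C * \<sigma> (Suc m) * (1 / (real m + 1))"
        using mD mD_pos C(1) \<sigma>_pos[of "Suc m"] by (intro mult_left_mono) (auto simp: field_simps)
      finally show "\<bar>z (Suc m) h - z (Suc m) h'\<bar> \<le> C / real (Suc m) * \<sigma> (Suc m)"
        by (simp add: add.commute)
    qed
  qed

  \<comment> \<open>The average is a convex combination of the coordinates, so the oscillation
    bounds the deviation from it.\<close>
  have z_\<sigma>: "\<bar>z m h - \<sigma> m\<bar> \<le> C / real m * \<sigma> m" if "m \<ge> N" "h \<in> J" for m h
  proof -
    have "\<bar>z m h - \<sigma> m\<bar> = \<bar>\<Sum>j\<in>J. \<pi> j * (z m h - z m j)\<bar>"
      using \<pi>_sum by (simp add: \<sigma>_def right_diff_distrib sum_subtractf flip: sum_distrib_right)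
    also have "\<dots> \<le> (\<Sum>j\<in>J. \<bar>\<pi> j * (z m h - z m j)\<bar>)" by (rule sum_abs)
    also have "\<dots> \<le> (\<Sum>j\<in>J. \<pi> j * (C / real m * \<sigma> m))"
    proof (rule sum_mono)
      fix j assume j: "j \<in> J"
      have "\<pi> j * \<bar>z m h - z m j\<bar> \<le> \<pi> j * (C / real m * \<sigma> m)"
        using osc[OF that(1)] that(2) j \<pi>_pos[OF j] by (intro mult_left_mono) auto
      thus "\<bar>\<pi> j * (z m h - z m j)\<bar> \<le> \<pi> j * (C / real m * \<sigma> m)"
        using \<pi>_pos[OF j] by (simp add: abs_mult)
    qed
    also have "\<dots> = C / real m * \<sigma> m" using \<pi>_sum by (simp only: sum_distrib_right[symmetric] mult_1)
    finally show ?thesis .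
  qed

  have ratio: "\<bar>\<sigma> (Suc m) / \<sigma> m - (1 - db / real m)\<bar> \<le> (C0 + D * C) * (1 / real m ^ 2)" if m: "m \<ge> N" for m
  proof -
    have m': "m \<ge> N0" "m \<ge> 1" using m N by auto
    \<comment> \<open>What remains after the mean drift \<open>db / m\<close>: the second-order part
      of the damping times \<open>z m j\<close>, and the first-order part times
      \<open>z m j - \<sigma> m\<close>. Both are O(\<sigma> m / m^2).\<close>
    define T where "T j = (w m j - (1 - d j / real m)) * z m j - d j / real m * (z m j - \<sigma> m)" for j
    have "\<sigma> (Suc m) - (1 - db / real m) * \<sigma> m =
        (\<Sum>j\<in>J. \<pi> j * (w m j * z m j)) - (\<Sum>j\<in>J. \<pi> j * z m j) + (\<Sum>j\<in>J. \<pi> j * d j) * (\<sigma> m / real m)"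
      by (simp add: \<sigma>_Suc db_def field_simps) (simp add: \<sigma>_def)
    also have "\<dots> = (\<Sum>j\<in>J. \<pi> j * T j)"
      unfolding sum_distrib_right sum_subtractf[symmetric] sum.distrib[symmetric] T_def
      by (intro sum.cong) (auto simp: algebra_simps add_divide_distrib diff_divide_distrib)
    finally have "\<bar>\<sigma> (Suc m) - (1 - db / real m) * \<sigma> m\<bar> \<le> (\<Sum>j\<in>J. \<bar>\<pi> j * T j\<bar>)"
      by (simp only: sum_abs)
    also have "\<dots> \<le> (\<Sum>j\<in>J. C0 / real m ^ 2 * (\<pi> j * z m j) + \<pi> j * (D * C / real m ^ 2 * \<sigma> m))"
    proof (rule sum_mono)
      fix j assume j: "j \<in> J"
      have "\<bar>(w m j - (1 - d j / real m)) * z m j\<bar> \<le> C0 / real m ^ 2 * z m j"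
        unfolding abs_mult abs_of_pos[OF z_pos[OF j]]
        by (intro mult_right_mono w_close[OF m'(1) j] less_imp_le[OF z_pos[OF j]])
      moreover have "\<bar>d j / real m * (z m j - \<sigma> m)\<bar> \<le> D / real m * (C / real m * \<sigma> m)"
        unfolding abs_mult
      proof (rule mult_mono[OF _ z_\<sigma>[OF m j]])
        have "\<bar>d j\<bar> \<le> D" using d_le[OF j] C0 by linarith
        thus "\<bar>d j / real m\<bar> \<le> D / real m" by (simp add: abs_divide divide_right_mono)
      qed (use D in auto)
      moreover have "D / real m * (C / real m * \<sigma> m) = D * C / real m ^ 2 * \<sigma> m"
        by (simp add: power2_eq_square)
      ultimately have "\<bar>T j\<bar> \<le> C0 / real m ^ 2 * z m j + D * C / real m ^ 2 * \<sigma> m"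
        unfolding T_def by linarith
      hence "\<pi> j * \<bar>T j\<bar> \<le> \<pi> j * (C0 / real m ^ 2 * z m j + D * C / real m ^ 2 * \<sigma> m)"
        using \<pi>_pos[OF j] by (intro mult_left_mono) auto
      also have "\<dots> = C0 / real m ^ 2 * (\<pi> j * z m j) + \<pi> j * (D * C / real m ^ 2 * \<sigma> m)"
        unfolding distrib_left by (simp only: mult_ac)
      finally show "\<bar>\<pi> j * T j\<bar> \<le> C0 / real m ^ 2 * (\<pi> j * z m j) + \<pi> j * (D * C / real m ^ 2 * \<sigma> m)"
        unfolding abs_mult abs_of_pos[OF \<pi>_pos[OF j]] .
    qed
    also have "\<dots> = C0 / real m ^ 2 * \<sigma> m + D * C / real m ^ 2 * \<sigma> m"
      using \<pi>_sum by (simp only: sum.distrib \<sigma>_def flip: sum_distrib_left sum_distrib_right)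
    finally have *: "\<bar>\<sigma> (Suc m) - (1 - db / real m) * \<sigma> m\<bar> \<le> (C0 + D * C) * (1 / real m ^ 2) * \<sigma> m"
      by (simp add: add_divide_distrib distrib_right)
    have "\<bar>\<sigma> (Suc m) / \<sigma> m - (1 - db / real m)\<bar> = \<bar>\<sigma> (Suc m) - (1 - db / real m) * \<sigma> m\<bar> / \<sigma> m"
      using \<sigma>_pos[of m] by (simp add: abs_if field_simps)
    also have "\<dots> \<le> (C0 + D * C) * (1 / real m ^ 2)"
      using * \<sigma>_pos[of m] by (simp add: pos_divide_le_eq)
    finally show ?thesis .
  qed
  have "(\<lambda>m. \<sigma> (Suc m) / \<sigma> m - (1 - db / real m)) \<in> O(\<lambda>m. 1 / real m ^ 2)"
    by (rule bigoI[of _ "C0 + D * C"]) (use ratio in \<open>auto simp: eventually_at_top_linorder\<close>)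
  from converges_from_ratio[OF \<sigma>_pos this] obtain \<gamma> where
    \<gamma>: "\<gamma> > 0" "(\<lambda>m. \<sigma> m * real m powr db) \<longlonglongrightarrow> \<gamma>" by blast
  have "(\<lambda>m. z m h * real m powr db) \<longlonglongrightarrow> \<gamma>" if h: "h \<in> J" for h
  proof -
    have "(\<lambda>m. z m h / \<sigma> m - 1) \<longlonglongrightarrow> 0"
    proof (rule Lim_null_comparison)
      show "\<forall>\<^sub>F m in sequentially. norm (z m h / \<sigma> m - 1) \<le> C / real m"
        using eventually_ge_at_top[of N]
      proof eventually_elim
        case (elim m)
        have "\<bar>z m h / \<sigma> m - 1\<bar> = \<bar>z m h - \<sigma> m\<bar> / \<sigma> m"
          using \<sigma>_pos[of m] by (simp add: abs_if field_simps)
        also have "\<dots> \<le> C / real m"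
          using z_\<sigma>[OF elim h] \<sigma>_pos[of m] by (simp add: pos_divide_le_eq)
        finally show ?case by simp
      qed
      show "(\<lambda>m. C / real m) \<longlonglongrightarrow> 0" by (rule lim_const_over_n)
    qed
    from tendsto_add[OF this tendsto_const[of 1]] have "(\<lambda>m. z m h / \<sigma> m) \<longlonglongrightarrow> 1" by simp
    from tendsto_mult[OF this \<gamma>(2)] show ?thesis using \<sigma>_pos by (simp add: less_imp_neq[symmetric])
  qed
  with \<gamma>(1) show ?thesis unfolding db_def by blast
qed

section \<open>The transfer recurrence in a strip\<close>

text \<open>
  \<open>strip_vec k\<close> is a right eigenvector, for the eigenvalue \<open>(strip_root k)\<^sup>2\<close>, of the limiting
  transfer matrix with entries \<open>1\<close> for \<open>1 \<le> j \<le> h + 1\<close>.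
\<close>

definition strip_angle :: "nat \<Rightarrow> real" where
  "strip_angle k = pi / (real k + 3)"

text \<open>Zero at 0 and \<open>k + 3\<close> and positive in between: the Dirichlet eigenvector of
  the path formed by the stack sizes 1 to k + 2. \<open>strip_root\<close> is its adjacency
  eigenvalue, squared in the growth rate because each merge is paired with a push.\<close>

definition strip_sin :: "nat \<Rightarrow> nat \<Rightarrow> real" where
  "strip_sin k j = sin (real j * strip_angle k)"

definition strip_root :: "nat \<Rightarrow> real" where
  "strip_root k = 2 * cos (strip_angle k)"

definition strip_vec :: "nat \<Rightarrow> nat \<Rightarrow> real" where
  "strip_vec k j = strip_root k ^ j * strip_sin k (Suc j)"

lemma strip_sin_pos: "1 \<le> j \<Longrightarrow> j \<le> k + 2 \<Longrightarrow> strip_sin k j > 0"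
  unfolding strip_sin_def
proof (intro sin_gt_zero)
  assume j: "1 \<le> j" "j \<le> k + 2"
  show "0 < real j * strip_angle k" using j by (simp add: strip_angle_def)
  have "pi * real j < pi * (real k + 3)" using j by (intro mult_strict_left_mono) auto
  thus "real j * strip_angle k < pi" by (simp add: strip_angle_def divide_less_eq mult.commute)
qed

lemma strip_sin_0 [simp]: "strip_sin k 0 = 0"
  by (simp add: strip_sin_def)

lemma strip_sin_reflect: "j \<le> k + 3 \<Longrightarrow> strip_sin k (k + 3 - j) = strip_sin k j"
proof -
  assume "j \<le> k + 3"
  hence "real (k + 3 - j) * strip_angle k = pi - real j * strip_angle k"
    by (simp add: strip_angle_def of_nat_diff field_simps)
  thus ?thesis by (simp add: strip_sin_def)
qed

lemma strip_sin_end [simp]: "strip_sin k (k + 3) = 0"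
  using strip_sin_reflect[of 0 k] by simp

lemma strip_sin_rec: "strip_sin k (Suc (Suc j)) = strip_root k * strip_sin k (Suc j) - strip_sin k j"
proof -
  define a where "a = strip_angle k"
  define b where "b = real (Suc j) * a"
  have "sin (b + a) + sin (b - a) = 2 * cos a * sin b"
    by (simp add: sin_add sin_diff)
  moreover have "real (Suc (Suc j)) * a = b + a" "real j * a = b - a"
    by (simp_all add: b_def algebra_simps)
  ultimately show ?thesis
    by (simp add: strip_sin_def strip_root_def b_def a_def)
qed

lemma strip_root_pos: "strip_root k > 0"
proof -
  have "pi / (real k + 3) \<le> pi / 3" by (intro divide_left_mono) auto
  hence "0 < strip_angle k" "strip_angle k < pi / 2"
    unfolding strip_angle_def using pi_gt_zero by (auto simp del: pi_gt_zero)
  thus ?thesis unfolding strip_root_def using cos_gt_zero by simp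
qed

lemma strip_vec_pos: "j \<le> k + 1 \<Longrightarrow> strip_vec k j > 0"
  unfolding strip_vec_def by (intro mult_pos_pos zero_less_power strip_root_pos strip_sin_pos) auto

text \<open>Telescopes: by \<open>strip_sin_rec\<close>, \<open>strip_vec k (h + 2)\<close> is
  \<open>strip_root k ^ 2\<close> times \<open>strip_vec k (h + 1) - strip_vec k h\<close>.\<close>

lemma sum_strip_vec: "(\<Sum>j=1..Suc h. strip_vec k j) = strip_root k ^ 2 * strip_vec k h"
proof (induction h)
  case 0
  show ?case using strip_sin_rec[of k 0] by (simp add: strip_vec_def power2_eq_square)
next
  case (Suc h)
  have "(\<Sum>j=1..Suc (Suc h). strip_vec k j) = strip_root k ^ 2 * strip_vec k h + strip_vec k (Suc (Suc h))"
    using Suc by simp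
  also have "\<dots> = strip_root k ^ 2 * strip_vec k (Suc h)"
    by (simp add: strip_vec_def power2_eq_square strip_sin_rec[of k "Suc h"] right_diff_distrib mult_ac)
  finally show ?case .
qed

text \<open>The last row is cut off at \<open>k + 1\<close>; its missing entry contains
  \<open>sin pi = 0\<close>.\<close>

lemma sum_strip_vec_min:
  assumes "h \<le> Suc k"
  shows "(\<Sum>j=1..min (Suc h) (Suc k). strip_vec k j) = strip_root k ^ 2 * strip_vec k h"
proof (cases "h = Suc k")
  case True
  have "strip_vec k (Suc (Suc k)) = 0"
    using strip_sin_end[of k] by (simp add: strip_vec_def numeral_3_eq_3)
  thus ?thesis using sum_strip_vec[of k h] True by simp
next
  case False
  thus ?thesis using sum_strip_vec[of k h] assms by (simp add: min_def)
qed

text \<open>The left eigenvector equation: column \<open>j = i + 1\<close> has its nonzero entries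
  in the rows \<open>h \<ge> i\<close>.\<close>

lemma sum_strip_sin:
  assumes "i \<le> Suc k"
  shows "(\<Sum>h=i..Suc k. strip_sin k h / strip_root k ^ h) = strip_root k ^ 2 * strip_sin k (Suc i) / strip_root k ^ Suc i"
proof -
  \<comment> \<open>A discrete antiderivative of the summand, by \<open>strip_sin_rec\<close>; it
    vanishes at the upper end since \<open>strip_sin k (k + 3) = 0\<close>.\<close>
  define F where "F h = - (strip_root k ^ 2 * strip_sin k (Suc h) / strip_root k ^ Suc h)" for h
  have "strip_sin k h / strip_root k ^ h = F (Suc h) - F h" for h
    using strip_root_pos[of k] by (simp add: F_def strip_sin_rec power2_eq_square field_simps)
  hence "(\<Sum>h=i..Suc k. strip_sin k h / strip_root k ^ h) = (\<Sum>h=i..Suc k. F (Suc h) - F h)"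
    by simp
  also have "\<dots> = F (Suc (Suc k)) - F i"
    using assms by (intro sum_Suc_diff) auto
  also have "F (Suc (Suc k)) = 0"
    using strip_sin_end[of k] by (simp add: F_def numeral_3_eq_3)
  finally show ?thesis by (simp add: F_def)
qed

section \<open>Damping factors and their stationary mean\<close>

text \<open>The base is \<open>1 - 1/m + O(1/m^2)\<close>; multiplying by this bounded factor keeps
  the order of the error.\<close>

lemma ratio_power_expansion:
  "(\<lambda>m. ((real m + 1) / (real m + 2)) ^ i - (1 - real i / real m)) \<in> O(\<lambda>m. 1 / real m ^ 2)"
proof (induction i)
  case (Suc i)
  define q :: "nat \<Rightarrow> real" where "q m = (real m + 1) / (real m + 2)" for m
  define c where "c = real i"
  have c: "c \<ge> 0" by (simp add: c_def)
  have "q \<in> O(\<lambda>_. 1)" unfolding q_def[abs_def] by real_asymp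
  from landau_o.big.mult[OF this Suc]
  have "(\<lambda>m. q m * (q m ^ i - (1 - real i / real m))) \<in> O(\<lambda>m. 1 / real m ^ 2)"
    by (simp add: q_def)
  moreover have "(\<lambda>m. q m * (1 - c / real m) - (1 - (c + 1) / real m)) \<in> O(\<lambda>m. 1 / real m ^ 2)"
    unfolding q_def using c by real_asymp
  ultimately have "(\<lambda>m. q m * (q m ^ i - (1 - real i / real m)) +
      (q m * (1 - c / real m) - (1 - (c + 1) / real m))) \<in> O(\<lambda>m. 1 / real m ^ 2)"
    by (rule sum_in_bigo)
  also have "(\<lambda>m. q m * (q m ^ i - (1 - real i / real m)) +
      (q m * (1 - c / real m) - (1 - (c + 1) / real m))) =
      (\<lambda>m. q m ^ Suc i - (1 - real (Suc i) / real m))"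
    by (simp add: fun_eq_iff c_def algebra_simps)
  finally show ?case by (simp add: q_def)
qed simp

text \<open>
  The stationary weights are symmetric under \<open>j \<mapsto> k + 2 - j\<close>, so \<open>j - 1\<close> has mean \<open>k / 2\<close>; this
  is the exponent in the theorem.
\<close>

lemma mean_strip:
  "(\<Sum>j=1..Suc k. strip_sin k j * strip_sin k (Suc j) * (real j - 1)) =
     real k / 2 * (\<Sum>j=1..Suc k. strip_sin k j * strip_sin k (Suc j))"
proof -
  define f where "f j = strip_sin k j * strip_sin k (Suc j)" for j
  have f: "f (k + 2 - j) = f j" if "j \<in> {1..Suc k}" for j
    using that strip_sin_reflect[of j k] strip_sin_reflect[of "Suc j" k]
    by (simp add: f_def Suc_diff_le mult.commute numeral_2_eq_2 numeral_3_eq_3)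
  have "(\<Sum>j=1..Suc k. f j * (real j - 1)) = (\<Sum>j=1..Suc k. f j * (real k + 1 - real j))"
    using f by (intro sum.reindex_bij_witness[of _ "\<lambda>j. k + 2 - j" "\<lambda>j. k + 2 - j"])
      (auto simp: of_nat_diff)
  moreover have "(\<Sum>j=1..Suc k. f j * (real j - 1)) + (\<Sum>j=1..Suc k. f j * (real k + 1 - real j)) =
      real k * (\<Sum>j=1..Suc k. f j)"
    by (simp add: sum_distrib_left algebra_simps flip: sum.distrib)
  ultimately show ?thesis by (simp add: f_def)
qed

section \<open>Normalised counts and their limit\<close>

text \<open>\<open>fact m\<close> and \<open>(m + 1) ^ h\<close> absorb the growth of the push
  weights. Dividing by the right eigenvector and by powers of its eigenvalue is a Doob transform,
  making the limiting matrix stochastic.\<close>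

definition scaled_count :: "nat \<Rightarrow> nat \<Rightarrow> nat \<Rightarrow> real" where
  "scaled_count k m h =
     real (forest_weight (Suc k) h m) / (fact m * (real m + 1) ^ h * (strip_root k ^ 2) ^ m * strip_vec k h)"

lemma forest_weight_pos: "h \<le> Suc k \<Longrightarrow> forest_weight (Suc k) h m > 0"
proof (induction m arbitrary: h)
  case (Suc m)
  have "0 < (m + 2) ^ (Suc h - 1) * forest_weight (Suc k) 1 m" using Suc by simp
  also have "\<dots> \<le> (\<Sum>j=1..min (Suc h) (Suc k). (m + 2) ^ (Suc h - j) * forest_weight (Suc k) j m)"
    by (rule member_le_sum) auto
  also have "\<dots> = forest_weight (Suc k) h (Suc m)" using Suc.prems by (subst forest_weight_eq_sum) auto
  finally show ?case .
qed (simp add: forest_weight_at_0)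

lemma scaled_count_pos: "h \<le> Suc k \<Longrightarrow> scaled_count k m h > 0"
  unfolding scaled_count_def
  using forest_weight_pos[of h k m] strip_vec_pos[of h k] strip_root_pos[of k]
  by (intro divide_pos_pos mult_pos_pos) auto

text \<open>The damping exponent is \<open>j - 1\<close> rather than \<open>j\<close> because
  \<open>fact (m + 1)\<close> takes up one factor \<open>m + 1\<close>.\<close>

lemma scaled_count_Suc:
  assumes h: "h \<le> Suc k"
  shows "scaled_count k (Suc m) h = (\<Sum>j=1..min (Suc h) (Suc k).
     strip_vec k j / (strip_root k ^ 2 * strip_vec k h) *
       (((real m + 1) / (real m + 2)) ^ (j - 1) * scaled_count k m j))"
proof -
  define L where "L = strip_root k ^ 2"
  have L: "L > 0" using strip_root_pos[of k] by (simp add: L_def)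
  have "scaled_count k (Suc m) h = (\<Sum>j=1..min (Suc h) (Suc k).
      (real m + 2) ^ (Suc h - j) * real (forest_weight (Suc k) j m) /
        (fact (Suc m) * (real m + 2) ^ h * L ^ Suc m * strip_vec k h))"
    unfolding scaled_count_def L_def[symmetric]
    by (subst forest_weight_eq_sum[OF h]) (simp_all add: sum_divide_distrib add_ac del: sum.cl_ivl_Suc min_Suc_Suc)
  also have "\<dots> = (\<Sum>j=1..min (Suc h) (Suc k). strip_vec k j / (L * strip_vec k h) *
       (((real m + 1) / (real m + 2)) ^ (j - 1) * scaled_count k m j))"
  proof (rule sum.cong[OF refl])
    fix j assume j: "j \<in> {1..min (Suc h) (Suc k)}"
    then obtain i where i: "j = Suc i" by (cases j) auto
    have jk: "j \<le> k + 1" using j by (simp del: min_Suc_Suc)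
    have nz: "strip_vec k j \<noteq> 0" "strip_vec k h \<noteq> 0"
      using strip_vec_pos[OF jk] strip_vec_pos[of h k] h by auto
    define x y where "x = real m + 1" and "y = real m + 2"
    have xy: "x > 0" "y > 0" by (auto simp: x_def y_def)
    have "i \<le> h" using j i by (simp del: min_Suc_Suc)
    hence pow: "y ^ i * y ^ (h - i) = y ^ h" by (simp flip: power_add)
    have "fact (Suc m) = x * (fact m :: real)" by (simp add: x_def algebra_simps)
    thus "(real m + 2) ^ (Suc h - j) * real (forest_weight (Suc k) j m) /
        (fact (Suc m) * (real m + 2) ^ h * L ^ Suc m * strip_vec k h) =
        strip_vec k j / (L * strip_vec k h) * (((real m + 1) / (real m + 2)) ^ (j - 1) * scaled_count k m j)"
      using nz xy L unfolding scaled_count_def L_def[symmetric] x_def[symmetric] y_def[symmetric]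
      by (simp add: i pow power_divide field_simps)
  qed
  finally show ?thesis by (simp add: L_def)
qed

lemma scaled_count_tendsto:
  "\<exists>\<gamma>>0. \<forall>h\<in>{1..Suc k}. (\<lambda>m. scaled_count k m h * real m powr (real k / 2)) \<longlonglongrightarrow> \<gamma>"
proof -
  \<comment> \<open>Index 0 is left out: the recurrence refers only to indices from 1 on.\<close>
  define J where "J = {1..Suc k}"
  define L where "L = strip_root k ^ 2"
  have L: "L > 0" using strip_root_pos[of k] by (simp add: L_def)
  define f where "f j = strip_sin k j * strip_sin k (Suc j)" for j
  define Z where "Z = sum f J"
  \<comment> \<open>The product of the left and right eigenvectors, in which the powers of
    \<open>strip_root k\<close> cancel, gives the stationary distribution.\<close>
  define \<pi> where "\<pi> j = f j / Z" for j
  define Q where "Q h j = (if j \<le> Suc h then strip_vec k j / (L * strip_vec k h) else 0)" for h j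
  have f_pos: "f j > 0" if "j \<in> J" for j
    using that unfolding f_def J_def by (intro mult_pos_pos strip_sin_pos) auto
  have Z: "Z > 0" unfolding Z_def using f_pos by (intro sum_pos) (auto simp: J_def)
  have v_pos: "strip_vec k j > 0" if "j \<in> J" for j
    using that strip_vec_pos[of j k] by (auto simp: J_def)
  have Q_sum_gen: "(\<Sum>j\<in>J. Q h j * g j) = (\<Sum>j=1..min (Suc h) (Suc k). strip_vec k j / (L * strip_vec k h) * g j)" for h g
    by (intro sum.mono_neutral_cong_right) (auto simp: J_def Q_def)
  \<comment> \<open>Every row has a positive entry in column 1, which gives the Doeblin minorisation
    with \<open>s = 1\<close>.\<close>
  define \<delta> where "\<delta> = Min ((\<lambda>h. Q h 1) ` J)"
  have Q1: "Q h 1 > 0" if "h \<in> J" for h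
    using v_pos[OF that] v_pos[of 1] that L by (auto simp: Q_def J_def)
  have mean: "(\<Sum>j\<in>J. \<pi> j * (real j - 1)) = real k / 2"
    using mean_strip[of k] Z by (simp add: \<pi>_def f_def Z_def J_def flip: sum_divide_distrib)
  have "\<exists>\<gamma>>0. \<forall>h\<in>J. (\<lambda>m. scaled_count k m h * real m powr (\<Sum>j\<in>J. \<pi> j * (real j - 1))) \<longlonglongrightarrow> \<gamma>"
  proof (rule perturbed_chain_asymptotics[where Q = Q and \<delta> = \<delta> and s = 1 and
      w = "\<lambda>m j. ((real m + 1) / (real m + 2)) ^ (j - 1)"])
    show "finite J" "1 \<in> J" by (auto simp: J_def)
    show "0 \<le> Q h j" if "h \<in> J" "j \<in> J" for h j
      using v_pos[OF that(1)] v_pos[OF that(2)] L by (auto simp: Q_def)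
    show "(\<Sum>j\<in>J. Q h j) = 1" if h: "h \<in> J" for h
    proof -
      have "(\<Sum>j\<in>J. Q h j) = (\<Sum>j=1..min (Suc h) (Suc k). strip_vec k j) / (L * strip_vec k h)"
        using Q_sum_gen[of h "\<lambda>_. 1"] by (simp flip: sum_divide_distrib)
      also have "\<dots> = 1"
        using h v_pos[OF h] L by (subst sum_strip_vec_min) (auto simp: J_def L_def)
      finally show ?thesis .
    qed
    show "\<delta> \<le> Q h 1" if "h \<in> J" for h
      using that unfolding \<delta>_def by (intro Min_le) (auto simp: J_def)
    show "\<delta> > 0" unfolding \<delta>_def using Q1 by (subst Min_gr_iff) (auto simp: J_def)
    show "0 < \<pi> j" if "j \<in> J" for j using f_pos[OF that] Z by (simp add: \<pi>_def)
    show "(\<Sum>j\<in>J. \<pi> j) = 1" using Z by (simp add: \<pi>_def Z_def flip: sum_divide_distrib)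
    show "(\<Sum>h\<in>J. \<pi> h * Q h j) = \<pi> j" if j: "j \<in> J" for j
    proof -
      obtain i where i: "j = Suc i" using j by (cases j) (auto simp: J_def)
      \<comment> \<open>For \<open>j = 1\<close> the range includes \<open>h = 0\<close>, which adds
        nothing because \<open>strip_sin k 0 = 0\<close>.\<close>
      have "(\<Sum>h\<in>J. \<pi> h * Q h j) = (\<Sum>h=i..Suc k. strip_vec k j / (L * Z) * (strip_sin k h / strip_root k ^ h))"
      proof (rule sum.mono_neutral_cong)
        fix h assume "h \<in> J \<inter> {i..Suc k}"
        hence "h \<in> J" "i \<le> h" by auto
        thus "\<pi> h * Q h j = strip_vec k j / (L * Z) * (strip_sin k h / strip_root k ^ h)"
          using strip_sin_pos[of "Suc h" k] L Z strip_root_pos[of k]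
          by (simp add: \<pi>_def Q_def f_def strip_vec_def i J_def field_simps)
      qed (use i in \<open>auto simp: J_def Q_def not_le\<close>)
      also have "\<dots> = strip_vec k j / (L * Z) * (L * strip_sin k j / strip_root k ^ j)"
        using j unfolding sum_distrib_left[symmetric]
        by (subst sum_strip_sin) (auto simp: i J_def L_def)
      also have "\<dots> = \<pi> j"
        using L Z strip_root_pos[of k] by (simp add: \<pi>_def f_def strip_vec_def)
      finally show ?thesis .
    qed
    show "0 < scaled_count k m j" if "j \<in> J" for m j
      using that by (intro scaled_count_pos) (auto simp: J_def)
    show "scaled_count k (Suc m) h = (\<Sum>j\<in>J. Q h j * (((real m + 1) / (real m + 2)) ^ (j - 1) * scaled_count k m j))"
      if "h \<in> J" for m h
      using that unfolding Q_sum_gen L_def by (intro scaled_count_Suc) (auto simp: J_def)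
    show "(\<lambda>m. ((real m + 1) / (real m + 2)) ^ (j - 1) - (1 - (real j - 1) / real m)) \<in> O(\<lambda>m. 1 / real m ^ 2)"
      if "j \<in> J" for j
      using ratio_power_expansion[of "j - 1"] that by (simp add: of_nat_diff J_def)
  qed
  thus ?thesis unfolding mean by (simp add: J_def)
qed

section \<open>Transfer of the asymptotics to relaxed trees\<close>

theorem mainTheorem1:
  fixes k :: nat
  shows "\<exists>\<gamma>::real.
    asymp_equiv (\<lambda>n. real (relaxed_count k n)) sequentially
      (\<lambda>n. \<gamma> * fact n * (4 * (cos (pi / (real k + 3)))\<^sup>2) ^ n * real n powr (- real k / 2))"
proof -
  define L where "L = 4 * (cos (pi / (real k + 3)))\<^sup>2"
  have L_eq: "L = strip_root k ^ 2" by (simp add: L_def strip_root_def strip_angle_def power_mult_distrib)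
  have L: "L > 0" using strip_root_pos[of k] by (simp add: L_eq)
  define v where "v = strip_vec k 1"
  have v: "v > 0" using strip_vec_pos[of 1 k] by (simp add: v_def)
  define c where "c = real k / 2"
  obtain \<gamma> where \<gamma>: "\<gamma> > 0" "(\<lambda>m. scaled_count k m 1 * real m powr c) \<longlonglongrightarrow> \<gamma>"
    using scaled_count_tendsto[of k] by (auto simp: c_def)
  \<comment> \<open>The count of size \<open>n + 1\<close> is expressed through
    \<open>L ^ n\<close>, which accounts for the division by \<open>L\<close>.\<close>
  define g where "g n = \<gamma> * v / L * fact n * L ^ n * real n powr (- c)" for n
  have count: "real (relaxed_count k (Suc n)) = scaled_count k n 1 * fact (Suc n) * L ^ n * v" for n
  proof -
    \<comment> \<open>Undoing the root merge leaves two subtrees with \<open>n\<close> inner nodes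
      in total; \<open>fact n * (n + 1) ^ 1\<close> then supplies
      \<open>fact (n + 1)\<close>.\<close>
    have "relaxed_count k (Suc n) = forest_weight (Suc k) 1 n"
      using forest_weight_0_Suc[of k n] by (simp only: relaxed_count_eq_trees_weight forest_weight.simps(1))
    moreover define q where "q = fact (Suc n) * L ^ n * v"
    have "scaled_count k n 1 = real (forest_weight (Suc k) 1 n) / q"
      by (simp add: scaled_count_def q_def L_eq v_def algebra_simps)
    moreover have "q > 0" using L v by (simp add: q_def del: fact_Suc)
    ultimately show ?thesis using L v by (simp add: q_def mult.assoc)
  qed
  \<comment> \<open>This factor turns \<open>n powr c\<close> into \<open>(n + 1) powr c\<close>, as
    the index is shifted by one.\<close>
  have "(\<lambda>n. (1 + 1 / real n) powr c) \<longlonglongrightarrow> (1 + 0) powr c"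
    by (intro tendsto_powr tendsto_add tendsto_const lim_1_over_n) auto
  from tendsto_mult[OF tendsto_divide[OF \<gamma>(2) tendsto_const[of \<gamma>]] this] \<gamma>(1)
  have "(\<lambda>n. scaled_count k n 1 * real n powr c / \<gamma> * (1 + 1 / real n) powr c) \<longlonglongrightarrow> 1"
    by simp
  moreover have "\<forall>\<^sub>F n in sequentially. scaled_count k n 1 * real n powr c / \<gamma> * (1 + 1 / real n) powr c =
      real (relaxed_count k (Suc n)) / g (Suc n)"
    using eventually_gt_at_top[of 0]
  proof eventually_elim
    case (elim n)
    have "real n powr c * (1 + 1 / real n) powr c = (real n * (1 + 1 / real n)) powr c"
      by (simp add: powr_mult)
    also have "real n * (1 + 1 / real n) = real (Suc n)" using elim by (simp add: field_simps)
    finally have "real n powr c * (1 + 1 / real n) powr c = real (Suc n) powr c" .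
    moreover have "real (relaxed_count k (Suc n)) / g (Suc n) = scaled_count k n 1 / \<gamma> * real (Suc n) powr c"
      using L v \<gamma>(1) by (simp add: count g_def powr_minus field_simps del: fact_Suc of_nat_Suc)
    ultimately show ?case by simp
  qed
  ultimately have "(\<lambda>n. real (relaxed_count k (Suc n)) / g (Suc n)) \<longlonglongrightarrow> 1"
    by (rule Lim_transform_eventually)
  hence "(\<lambda>n. real (relaxed_count k n) / g n) \<longlonglongrightarrow> 1" by (rule LIMSEQ_imp_Suc)
  hence "(\<lambda>n. real (relaxed_count k n)) \<sim>[sequentially] g" by (rule asymp_equivI')
  thus ?thesis unfolding g_def L_def c_def by (intro exI[of _ "\<gamma> * v / L"]) (simp add: L_def)
qed

end
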